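(* Let $\{P_n(x)\}_{n\ge 1}$ be the sequence defined in the context. For all integers $n\ge 1$ and $k\ge 1$, $$P_n(k)=\begin{cases}\dfrac{\binom{(n-1)/2+k-1}{k-1}}{\binom{n+2k-2}{k-1}}\left(\frac{n-1}{2}\right)!\,T_n(k), & n \text{ odd},\\[2ex] \dfrac{\binom{n/2+k-1}{k}}{\binom{n+2k-1}{k}}\left(\frac{n}{2}-1\right)!\,T_n(k), & n\text{ even},\end{cases}$$ and also $$P_n(k)=2^{-(\lfloor n/2\rfloor+k-1)}\,\frac{(n+k-1)!}{(2\lfloor n/2\rfloor+2k-1)!!}\,T_n(k),$$ where $T_n(k)=\sum_{i=1}^{n}2^{i-1}\binom{n+2k-i-1}{k-1}$.
   Context: The sequence $\{P_n(x)\}_{n\ge1}$ of rational functions of $x$ is defined by $P_1=P_2=1$ and, for $n\ge 2$: if $n$ is odd, $4(2x+n)P_{n+1}(x)=2(x+n)P_n(x)+(2x+n)P_n(x+1)+(4x+n)\ell_n(x)$; if $n$ is even, $4P_{n+1}(x)=4(x+n)P_n(x)+2(2x+n+1)P_n(x+1)+(4x+n)\ell_{n-1}(x)$. Here for odd $r\ge1$, $\ell_r(x)=\prod_{j=1}^{(r-1)/2}(x+j)$ (the empty product equals $1$). For a positive integer $N$, $N!!$ denotes the product of all positive integers $\le N$ having the same parity as $N$. *)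

theory Defs
  imports
    "HOL-Computational_Algebra.Computational_Algebra"
    "HOL-Computational_Algebra.Field_as_Ring"
begin

type_synonym ratfun = "rat poly fract"

definition X :: ratfun where
  "X = to_fract [:0, 1:]"

(* x/0 = 0: at a pole of f this returns 0.  Since quot_of_fract yields a coprime pair,
   the denominator vanishes at a only if f really has a pole there. *)
definition rf_eval :: "ratfun \<Rightarrow> rat \<Rightarrow> rat" where
  "rf_eval f a = poly (fst (quot_of_fract f)) a / poly (snd (quot_of_fract f)) a"

(* f(x) becomes f(x + 1) *)
definition rf_shift :: "ratfun \<Rightarrow> ratfun" where
  "rf_shift f = Fract (pcompose (fst (quot_of_fract f)) [:1, 1:])
                      (pcompose (snd (quot_of_fract f)) [:1, 1:])"

lemma quot_of_fract_Fract_cross: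
  fixes p q :: "rat poly"
  assumes "q \<noteq> 0"
  shows "fst (quot_of_fract (Fract p q)) * q = p * snd (quot_of_fract (Fract p q))"
proof -
  have "Fract (fst (quot_of_fract (Fract p q))) (snd (quot_of_fract (Fract p q))) = Fract p q"
    by simp
  then show ?thesis
    using assms by (subst (asm) eq_fract) auto
qed

lemma rf_eval_Fract:
  assumes "poly q a \<noteq> 0"
  shows "rf_eval (Fract p q) a = poly p a / poly q a"
proof -
  define u v where "u = fst (quot_of_fract (Fract p q))" and "v = snd (quot_of_fract (Fract p q))"
  have q0: "q \<noteq> 0" using assms by auto
  have uv: "u * q = p * v"
    using quot_of_fract_Fract_cross[OF q0] by (simp add: u_def v_def)
  have "coprime u v" by (simp add: u_def v_def coprime_quot_of_fract)
  moreover have "v dvd u * q" using uv by simp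
  ultimately have "v dvd q" by (simp add: coprime_commute coprime_dvd_mult_right_iff)
  then have "poly v a \<noteq> 0" using assms by auto
  moreover have "poly u a * poly q a = poly p a * poly v a"
    using uv by (metis poly_mult)
  ultimately show ?thesis
    using assms by (simp add: rf_eval_def u_def[symmetric] v_def[symmetric] field_simps)
qed

lemma rf_shift_Fract:
  assumes "q \<noteq> 0"
  shows "rf_shift (Fract p q) = Fract (pcompose p [:1, 1:]) (pcompose q [:1, 1:])"
proof -
  define u v where "u = fst (quot_of_fract (Fract p q))" and "v = snd (quot_of_fract (Fract p q))"
  have "u * q = p * v"
    using quot_of_fract_Fract_cross[OF assms] by (simp add: u_def v_def)
  then have "pcompose u [:1, 1:] * pcompose q [:1, 1:] = pcompose p [:1, 1:] * pcompose v [:1, 1:]"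
    by (metis pcompose_mult)
  moreover have "v \<noteq> 0" by (simp add: v_def)
  ultimately show ?thesis
    using assms by (simp add: rf_shift_def u_def[symmetric] v_def[symmetric] eq_fract pcompose_eq_0_iff)
qed

definition ell :: "nat \<Rightarrow> ratfun" where
  "ell r = (\<Prod>j = 1..(r - 1) div 2. X + of_nat j)"

(* P 0 is a dummy value.  The recurrences are solved for P (n + 1) here;
   P_rec_odd and P_rec_even below restore their undivided form. *)
primrec P :: "nat \<Rightarrow> ratfun" where
  "P 0 = 0"
| "P (Suc n) =
    (if n < 2 then 1
     else if odd n then
       (2 * (X + of_nat n) * P n + (2 * X + of_nat n) * rf_shift (P n)
         + (4 * X + of_nat n) * ell n) / (4 * (2 * X + of_nat n))
     else
       (4 * (X + of_nat n) * P n + 2 * (2 * X + of_nat n + 1) * rf_shift (P n)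
         + (4 * X + of_nat n) * ell (n - 1)) / 4)"

lemma of_nat_ratfun: "(of_nat n :: ratfun) = to_fract (of_nat n)"
  by (induction n) simp_all

lemma two_X_plus_nonzero: "2 * X + of_nat n \<noteq> 0"
proof -
  have "2 * X + of_nat n = to_fract ([:0, 1:] + [:0, 1:] + of_nat n)"
    by (simp only: X_def of_nat_ratfun to_fract_add mult_2)
  moreover have "[:0, 1:] + [:0, 1:] + of_nat n \<noteq> (0 :: rat poly)"
    by (simp add: of_nat_poly)
  ultimately show ?thesis by (simp del: to_fract_add)
qed

lemma four_ratfun_nonzero: "(4 :: ratfun) \<noteq> 0"
proof -
  have "(4 :: ratfun) = to_fract (of_nat 4)"
    using of_nat_ratfun[of 4] by simp
  then show ?thesis by (simp del: of_nat_numeral add: of_nat_poly)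
qed

lemma P_1: "P 1 = 1" and P_2: "P 2 = 1"
  by (simp_all add: numeral_2_eq_2)

lemma P_rec_odd:
  assumes "n \<ge> 2" "odd n"
  shows "4 * (2 * X + of_nat n) * P (n + 1) =
         2 * (X + of_nat n) * P n + (2 * X + of_nat n) * rf_shift (P n)
           + (4 * X + of_nat n) * ell n"
  using assms two_X_plus_nonzero[of n] four_ratfun_nonzero by simp

lemma P_rec_even:
  assumes "n \<ge> 2" "even n"
  shows "4 * P (n + 1) =
         4 * (X + of_nat n) * P n + 2 * (2 * X + of_nat n + 1) * rf_shift (P n)
           + (4 * X + of_nat n) * ell (n - 1)"
  using assms four_ratfun_nonzero by simp

definition double_fact :: "nat \<Rightarrow> nat" where
  "double_fact N = \<Prod>{j \<in> {1..N}. even j \<longleftrightarrow> even N}"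

definition T :: "nat \<Rightarrow> nat \<Rightarrow> nat" where
  "T n k = (\<Sum>i = 1..n. 2 ^ (i - 1) * ((n + 2 * k - i - 1) choose (k - 1)))"

end

theory Submission
  imports Defs
begin

text \<open>
  Both formulas say \<open>P\<^sub>n(k) = c(n,k) T\<^sub>n(k)\<close> with the prefactor
  \<open>c(n,k) = (m + k - 1)! (n + k - 1)! / (2m + 2k - 1)!\<close>, \<open>m = \<lfloor>n/2\<rfloor>\<close>.
  Dividing either recurrence for \<open>P\<close> by the prefactor yields the same relation
  \<open>4 T\<^sub>n\<^sub>+\<^sub>1(k) = 4 T\<^sub>n(k) + T\<^sub>n(k+1) + (4k+n)/(n+k) binom(n+2k-1, k)\<close>, regardless of the parity of \<open>n\<close>;
  it follows by induction on \<open>n\<close> from \<open>T\<^sub>n\<^sub>+\<^sub>1(k) = 2 T\<^sub>n(k) + binom(n+2k-1, k-1)\<close> and Pascal's rule.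
\<close>

section \<open>Values of rational functions\<close>

text \<open>Unlike an equation \<open>rf_eval f a = v\<close>, this fails at a pole, so it is preserved by sums and products.\<close>

definition has_value :: "ratfun \<Rightarrow> rat \<Rightarrow> rat \<Rightarrow> bool" where
  "has_value f a v \<longleftrightarrow> (\<exists>p q. f = Fract p q \<and> poly q a \<noteq> 0 \<and> v = poly p a / poly q a)"

lemma has_valueI:
  "f = Fract p q \<Longrightarrow> poly q a \<noteq> 0 \<Longrightarrow> v = poly p a / poly q a \<Longrightarrow> has_value f a v"
  by (auto simp: has_value_def)

lemma has_valueE:
  assumes "has_value f a v"
  obtains p q where "f = Fract p q" "q \<noteq> 0" "poly q a \<noteq> 0" "v = poly p a / poly q a"
  using assms unfolding has_value_def by (metis poly_0)

text \<open>A witness for \<open>has_value\<close> need not be in lowest terms;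
  \<open>rf_eval_Fract\<close> makes the value independent of the representation.\<close>

lemma rf_eval_has_value: "has_value f a v \<Longrightarrow> rf_eval f a = v"
  by (elim has_valueE) (simp add: rf_eval_Fract)

lemma has_value_to_fract: "has_value (to_fract p) a (poly p a)"
  by (rule has_valueI[of _ p 1]) (simp_all add: to_fract_def)

lemma has_value_X: "has_value X a a"
  using has_value_to_fract[of "[:0, 1:]" a] by (simp add: X_def)

lemma has_value_of_nat: "has_value (of_nat n) a (of_nat n)"
  using has_value_to_fract[of "of_nat n" a] by (simp add: of_nat_ratfun)

lemma has_value_1: "has_value 1 a 1"
  using has_value_of_nat[of 1 a] by simp

lemma has_value_numeral: "has_value (numeral n) a (numeral n)"
  using has_value_of_nat[of "numeral n" a] by simp

lemma has_value_add:
  assumes "has_value f a u" "has_value g a v"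
  shows "has_value (f + g) a (u + v)"
proof -
  obtain p q where f: "f = Fract p q" "q \<noteq> 0" "poly q a \<noteq> 0" "u = poly p a / poly q a"
    using assms(1) by (rule has_valueE)
  obtain r s where g: "g = Fract r s" "s \<noteq> 0" "poly s a \<noteq> 0" "v = poly r a / poly s a"
    using assms(2) by (rule has_valueE)
  show ?thesis
    by (rule has_valueI[of _ "p * s + r * q" "q * s"]) (use f g in \<open>simp_all add: add_divide_distrib\<close>)
qed

lemma has_value_mult:
  assumes "has_value f a u" "has_value g a v"
  shows "has_value (f * g) a (u * v)"
proof -
  obtain p q where f: "f = Fract p q" "q \<noteq> 0" "poly q a \<noteq> 0" "u = poly p a / poly q a"
    using assms(1) by (rule has_valueE)
  obtain r s where g: "g = Fract r s" "s \<noteq> 0" "poly s a \<noteq> 0" "v = poly r a / poly s a"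
    using assms(2) by (rule has_valueE)
  show ?thesis
    by (rule has_valueI[of _ "p * r" "q * s"]) (use f g in simp_all)
qed

lemma has_value_divide:
  assumes "has_value f a u" "has_value g a v" "v \<noteq> 0"
  shows "has_value (f / g) a (u / v)"
proof -
  obtain p q where f: "f = Fract p q" "q \<noteq> 0" "poly q a \<noteq> 0" "u = poly p a / poly q a"
    using assms(1) by (rule has_valueE)
  obtain r s where g: "g = Fract r s" "s \<noteq> 0" "poly s a \<noteq> 0" "v = poly r a / poly s a"
    using assms(2) by (rule has_valueE)
  have "poly r a \<noteq> 0" using g assms(3) by auto
  then show ?thesis
    by (intro has_valueI[of _ "p * s" "q * r"]) (use f g in simp_all)
qed

lemma has_value_prod:
  assumes "\<And>i. i \<in> A \<Longrightarrow> has_value (f i) a (v i)"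
  shows "has_value (prod f A) a (prod v A)"
  using assms by (induction A rule: infinite_finite_induct) (auto intro: has_value_1 has_value_mult)

lemma has_value_rf_shift:
  assumes "has_value f (a + 1) v"
  shows "has_value (rf_shift f) a v"
proof -
  obtain p q where f: "f = Fract p q" "q \<noteq> 0" "poly q (a + 1) \<noteq> 0" "v = poly p (a + 1) / poly q (a + 1)"
    using assms by (rule has_valueE)
  show ?thesis
    by (rule has_valueI[of _ "pcompose p [:1, 1:]" "pcompose q [:1, 1:]"])
      (use f in \<open>simp_all add: rf_shift_Fract poly_pcompose add.commute\<close>)
qed

lemmas has_value_intros =
  has_value_X has_value_of_nat has_value_1 has_value_numeral has_value_add has_value_mult has_value_divide

text \<open>At \<open>k\<close> the product telescopes to (k+1)...(k+m).\<close>

lemma has_value_ell: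
  "has_value (ell (2 * m + 1)) (of_nat k) (fact (k + m) / fact k)"
proof -
  have "fact (k + m) / fact k = (\<Prod>j = 1..m. (of_nat k + of_nat j :: rat))"
    by (induction m) (simp_all add: field_simps)
  then show ?thesis
    by (auto simp: ell_def intro!: has_value_prod has_value_intros)
qed

section \<open>Recurrences for the sums\<close>

lemma T_0: "T 0 k = 0"
  by (simp add: T_def)

text \<open>Split off the term i = 1. In the rest, raising n and i together leaves n - i, hence the
  binomial, unchanged, and each power of 2 doubles.\<close>

lemma T_Suc_left:
  assumes "k \<ge> 1"
  shows "T (Suc n) k = 2 * T n k + ((n + 2 * k - 1) choose (k - 1))"
proof -
  have "T (Suc n) k =
      (\<Sum>i = 0..n. 2 ^ i * ((Suc n + 2 * k - Suc i - 1) choose (k - 1)))"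
    unfolding T_def by (simp add: sum.atLeast_Suc_atMost_Suc_shift del: sum.cl_ivl_Suc)
  also have "\<dots> = ((n + 2 * k - 1) choose (k - 1))
      + (\<Sum>i = 1..n. 2 ^ i * ((n + 2 * k - i - 1) choose (k - 1)))"
    by (simp add: sum.atLeast_Suc_atMost)
  also have "(\<Sum>i = 1..n. 2 ^ i * ((n + 2 * k - i - 1) choose (k - 1))) = 2 * T n k"
    unfolding T_def sum_distrib_left
  proof (rule sum.cong)
    fix i assume "i \<in> {1..n}"
    then show "2 ^ i * (n + 2 * k - i - 1 choose (k - 1))
        = 2 * (2 ^ (i - 1) * (n + 2 * k - i - 1 choose (k - 1)))"
      by (cases i) simp_all
  qed simp
  finally show ?thesis by simp
qed

text \<open>Two binomials with integer coefficients keep the relation free of division, so the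
  induction runs in \<open>nat\<close>.\<close>

lemma T_shift_rec:
  assumes "k \<ge> 1"
  shows "4 * T (Suc n) k = 4 * T n k + T n (Suc k)
    + ((n + 2 * k - 1) choose k) + 3 * ((n + 2 * k - 1) choose (k - 1))"
proof (induction n)
  case 0
  obtain j where k: "k = Suc j" using assms by (cases k) auto
  \<comment> \<open>For n = 0 the relation reduces to 4b = b' + 3b, where b and b' are the two
    central binomials of row 2k - 1.\<close>
  have "(2 * k - 1) choose k = (2 * k - 1) choose (k - 1)"
    by (subst binomial_symmetric) (simp_all add: k)
  then show ?case using assms by (simp add: T_Suc_left T_0)
next
  case (Suc n)
  obtain j where k: "k = Suc j" using assms by (cases k) auto
  have "T (Suc (Suc n)) k = 2 * T (Suc n) k + ((n + 2 * k) choose (k - 1))"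
    "T (Suc n) (Suc k) = 2 * T n (Suc k) + ((n + 2 * k + 1) choose k)"
    "T (Suc n) k = 2 * T n k + ((n + 2 * k - 1) choose (k - 1))"
    using assms T_Suc_left[of k "Suc n"] T_Suc_left[of "Suc k" n] T_Suc_left[of k n] by simp_all
  moreover have "(n + 2 * k + 1) choose k = ((n + 2 * k) choose k) + ((n + 2 * k) choose (k - 1))"
    "(n + 2 * k) choose k = ((n + 2 * k - 1) choose k) + ((n + 2 * k - 1) choose (k - 1))"
    by (simp_all add: k)
  ultimately show ?case using Suc.IH by simp
qed

text \<open>Multiplying by n + k, with k = \<open>Suc j\<close>, merges the two binomials: (n+k)
  binom(n+2k-1, k-1) = k binom(n+2k-1, k), so the coefficients add up to (n+k) + 3k = n + 4k. The
  quotient of factorials is binom(n+2k-1, k).\<close>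

lemma T_shift_rec_rat:
  "4 * of_nat (n + Suc j) * of_nat (T (Suc n) (Suc j)) =
   of_nat (n + Suc j) * (4 * of_nat (T n (Suc j)) + of_nat (T n (Suc (Suc j))))
    + of_nat (n + 4 * Suc j) * (fact (n + 2 * j + 1) / (fact (Suc j) * fact (n + j)) :: rat)"
proof -
  have b1: "of_nat ((n + 2 * j + 1) choose Suc j)
      = (fact (n + 2 * j + 1) / (fact (Suc j) * fact (n + j)) :: rat)"
    by (subst binomial_fact) (simp_all add: mult_2 add.commute del: fact_Suc)
  have "n + 2 * j + 1 - j = Suc (n + j)" by simp
  then have b2: "of_nat ((n + 2 * j + 1) choose j)
      = (fact (n + 2 * j + 1) / (fact j * fact (Suc (n + j))) :: rat)"
    by (subst binomial_fact) (simp_all add: add.commute del: fact_Suc)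
  have b3: "of_nat (n + Suc j) * (of_nat ((n + 2 * j + 1) choose Suc j) + 3 * of_nat ((n + 2 * j + 1) choose j))
     = of_nat (n + 4 * Suc j) * (fact (n + 2 * j + 1) / (fact (Suc j) * fact (n + j)) :: rat)"
  proof -
    have 1: "of_nat (n + Suc j) * of_nat ((n + 2 * j + 1) choose j)
      = of_nat (Suc j) * (fact (n + 2 * j + 1) / (fact (Suc j) * fact (n + j)) :: rat)"
      unfolding b2 fact_Suc by (simp add: divide_simps del: of_nat_Suc of_nat_add)
    have "of_nat (n + Suc j) * w + 3 * (of_nat (Suc j) * w) = of_nat (n + 4 * Suc j) * w" for w :: rat
      by (simp add: algebra_simps)
    then show ?thesis unfolding distrib_left mult.left_commute[of _ 3] 1 b1 .
  qed
  have "of_nat (4 * T (Suc n) (Suc j)) = (of_nat (4 * T n (Suc j) + T n (Suc (Suc j))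
    + ((n + 2 * j + 1) choose Suc j) + 3 * ((n + 2 * j + 1) choose j)) :: rat)"
    using T_shift_rec[of "Suc j" n] by simp
  then have "4 * of_nat (T (Suc n) (Suc j)) = (4 * of_nat (T n (Suc j)) + of_nat (T n (Suc (Suc j)))
    + (of_nat ((n + 2 * j + 1) choose Suc j) + 3 * of_nat ((n + 2 * j + 1) choose j)) :: rat)"
    by simp
  then show ?thesis unfolding b3[symmetric] mult.assoc mult.left_commute[of 4]
    by (simp only: distrib_left)
qed

section \<open>The closed form\<close>

definition prefactor :: "nat \<Rightarrow> nat \<Rightarrow> rat" where
  "prefactor n k = fact (n div 2 + k - 1) * fact (n + k - 1) / fact (2 * (n div 2) + 2 * k - 1)"

lemma prefactor_odd_Suc:
  "prefactor (2 * m + 1) (Suc j) = fact (m + j) * fact (2 * m + j + 1) / fact (2 * m + 2 * j + 1)"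
  by (simp add: prefactor_def del: fact_Suc)

lemma prefactor_even_Suc:
  "prefactor (2 * m) (Suc j) = fact (m + j) * fact (2 * m + j) / fact (2 * m + 2 * j + 1)"
  by (simp add: prefactor_def del: fact_Suc)

text \<open>This is the odd recurrence at x = k with the closed form in place of \<open>P\<close>.
  Once every term is expressed through \<open>c\<close>, \<open>s\<close>, \<open>t\<close> and
  \<open>w\<close>, both sides share the factor c/(8t), and \<open>T_shift_rec_rat\<close>
  remains.\<close>

lemma prefactor_T_Suc_odd:
  assumes "n = 2 * m + 1" "k = Suc j"
  shows "prefactor (Suc n) k * of_nat (T (Suc n) k) =
    (2 * (of_nat k + of_nat n) * (prefactor n k * of_nat (T n k))
      + (2 * of_nat k + of_nat n) * (prefactor n (Suc k) * of_nat (T n (Suc k)))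
      + (4 * of_nat k + of_nat n) * (fact (k + m) / fact k)) / (4 * (2 * of_nat k + of_nat n))"
proof -
  define c w where "c = prefactor n k"
    and "w = (fact (n + 2 * j + 1) / (fact (Suc j) * fact (n + j)) :: rat)"
  define A B C where "A = (of_nat (T n k) :: rat)"
    and "B = (of_nat (T n (Suc k)) :: rat)" and "C = (of_nat (T (Suc n) k) :: rat)"
  define s t where "s = (of_nat k + of_nat n :: rat)" and "t = (2 * of_nat k + of_nat n :: rat)"
  have t: "t \<noteq> 0" unfolding t_def assms
    by (metis of_nat_add of_nat_mult of_nat_numeral of_nat_eq_0_iff add_is_0 mult_is_0
        nat.distinct(1) zero_neq_numeral)
  have f: "(fact (2 * m + 2 * j + 3) :: rat) = t * (2 * of_nat (m + j + 1)) * fact (2 * m + 2 * j + 1)"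
    by (simp add: eval_nat_numeral t_def assms algebra_simps)
  have "prefactor n (Suc k) = fact (Suc (m + j)) * fact (Suc (2 * m + j + 1)) / fact (2 * m + 2 * j + 3)"
    unfolding assms prefactor_odd_Suc by (simp add: eval_nat_numeral del: fact_Suc)
  also have "\<dots> = (of_nat (m + j + 1) * fact (m + j)) * (s * fact (2 * m + j + 1)) / fact (2 * m + 2 * j + 3)"
    unfolding fact_Suc[of "m + j"] fact_Suc[of "2 * m + j + 1"]
    by (simp add: s_def assms add_ac del: fact_Suc)
  also have "\<dots> = c * s / (2 * t)"
    unfolding f c_def assms prefactor_odd_Suc using t
    by (simp add: divide_simps del: of_nat_Suc of_nat_add fact_Suc)
  finally have c1: "prefactor n (Suc k) = c * s / (2 * t)" .
  \<comment> \<open>For odd n, passing to n + 1 raises \<open>n div 2\<close> by one, so it changes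
    the prefactor exactly as passing from k to k + 1 does.\<close>
  have "Suc n = 2 * Suc m" by (simp add: assms)
  then have c2: "prefactor (Suc n) k = prefactor n (Suc k)"
    unfolding assms prefactor_odd_Suc by (simp only: prefactor_even_Suc) (simp del: fact_Suc)
  have "fact (n + 2 * j + 1) = (2 * of_nat (m + j + 1) * fact (2 * m + 2 * j + 1) :: rat)"
    by (simp add: assms algebra_simps)
  then have w: "w = 2 * of_nat (m + j + 1) * fact (2 * m + 2 * j + 1) / (fact k * fact (2 * m + j + 1))"
    by (simp add: w_def assms add_ac del: fact_Suc of_nat_add)
  have "fact (k + m) = (of_nat (m + j + 1) * fact (m + j) :: rat)"
    by (simp add: assms add_ac)
  then have e: "fact (k + m) / fact k = c * w / 2"
    unfolding w c_def assms(1) prefactor_odd_Suc unfolding assms(2) prefactor_odd_Suc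
    by (simp add: divide_simps del: of_nat_Suc of_nat_add fact_Suc)
  have "4 * s * C = s * (4 * A + B) + (4 * of_nat k + of_nat n) * w"
    using T_shift_rec_rat[of n j] by (simp add: A_def B_def C_def s_def w_def assms algebra_simps)
  then have "4 * c * s * C = 4 * c * s * A + c * s * B + (4 * of_nat k + of_nat n) * c * w"
    by algebra
  then show ?thesis
    unfolding c2 c1 e c_def[symmetric] A_def[symmetric] B_def[symmetric] C_def[symmetric]
      s_def[symmetric] t_def[symmetric]
    using t by (simp add: divide_simps) (simp add: algebra_simps)
qed

text \<open>As in the odd case, now with common factor c/4. Here \<open>m\<close> is
  \<open>n div 2 - 1\<close>, the number of factors of \<open>ell (n - 1)\<close>.\<close>

lemma prefactor_T_Suc_even:
  assumes "n = 2 * Suc m" "k = Suc j"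
  shows "prefactor (Suc n) k * of_nat (T (Suc n) k) =
    (4 * (of_nat k + of_nat n) * (prefactor n k * of_nat (T n k))
      + 2 * (2 * of_nat k + of_nat n + 1) * (prefactor n (Suc k) * of_nat (T n (Suc k)))
      + (4 * of_nat k + of_nat n) * (fact (k + m) / fact k)) / 4"
proof -
  define c w where "c = prefactor n k"
    and "w = (fact (n + 2 * j + 1) / (fact (Suc j) * fact (n + j)) :: rat)"
  define A B C where "A = (of_nat (T n k) :: rat)"
    and "B = (of_nat (T n (Suc k)) :: rat)" and "C = (of_nat (T (Suc n) k) :: rat)"
  define s t where "s = (of_nat k + of_nat n :: rat)" and "t = (2 * of_nat k + of_nat n + 1 :: rat)"
  have "t = of_nat (Suc (2 * k + n))" by (simp add: t_def)
  then have t: "t \<noteq> 0" by (metis of_nat_neq_0)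
  have f: "(fact (n + 2 * j + 3) :: rat) = t * (2 * of_nat (m + j + 2)) * fact (n + 2 * j + 1)"
    by (simp add: eval_nat_numeral t_def assms algebra_simps)
  have "prefactor n (Suc k) = fact (Suc (Suc m + j)) * fact (Suc (n + j)) / fact (n + 2 * j + 3)"
    unfolding assms prefactor_even_Suc by (simp add: eval_nat_numeral del: fact_Suc)
  also have "\<dots> = (of_nat (m + j + 2) * fact (Suc m + j)) * (s * fact (n + j)) / fact (n + 2 * j + 3)"
    unfolding fact_Suc[of "Suc m + j"] fact_Suc[of "n + j"]
    by (simp add: s_def assms add_ac del: fact_Suc)
  also have "\<dots> = c * s / (2 * t)"
    unfolding f unfolding c_def assms prefactor_even_Suc using t
    by (simp add: divide_simps del: of_nat_Suc of_nat_add fact_Suc)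
  finally have c1: "prefactor n (Suc k) = c * s / (2 * t)" .
  \<comment> \<open>For even n, passing to n + 1 keeps \<open>n div 2\<close>, so only (n+k-1)!
    grows, by the factor n + k.\<close>
  have "prefactor (Suc n) k = fact (Suc m + j) * fact (Suc (n + j)) / fact (n + 2 * j + 1)"
    using prefactor_odd_Suc[of "Suc m" j] by (simp add: assms del: fact_Suc)
  also have "\<dots> = c * s"
    unfolding c_def assms prefactor_even_Suc fact_Suc[of "2 * Suc m + j"]
    by (simp add: s_def assms add_ac del: fact_Suc)
  finally have c2: "prefactor (Suc n) k = c * s" .
  have e: "fact (k + m) / fact k = c * w"
    unfolding c_def w_def assms prefactor_even_Suc by (simp add: add_ac del: of_nat_Suc fact_Suc)
  have "4 * s * C = s * (4 * A + B) + (4 * of_nat k + of_nat n) * w"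
    using T_shift_rec_rat[of n j] by (simp add: A_def B_def C_def s_def w_def assms algebra_simps)
  then have "4 * c * s * C = 4 * c * s * A + c * s * B + (4 * of_nat k + of_nat n) * c * w"
    by algebra
  then show ?thesis
    unfolding c2 c1 e c_def[symmetric] A_def[symmetric] B_def[symmetric] C_def[symmetric]
      s_def[symmetric] t_def[symmetric]
    using t by (simp add: divide_simps) (simp add: algebra_simps)
qed

section \<open>Values of \<open>P\<close> at positive integers\<close>

lemma prefactor_T_1:
  "prefactor 1 (Suc j) * of_nat (T 1 (Suc j)) = 1"
proof -
  have "2 * j + 1 - j = Suc j" by simp
  then have "of_nat ((2 * j + 1) choose j) = (fact (2 * j + 1) / (fact j * fact (Suc j)) :: rat)"
    by (subst binomial_fact) simp_all
  then show ?thesis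
    by (simp add: prefactor_def T_Suc_left T_0 del: fact_Suc)
qed

text \<open>Although \<open>P 2\<close> is an initial value, the odd recurrence at n = 1 reproduces
  it: its numerator 2(k+1) + (2k+1) + (4k+1) equals its denominator 4(2k+1).\<close>

lemma prefactor_T_2:
  "prefactor 2 (Suc j) * of_nat (T 2 (Suc j)) = 1"
proof -
  \<comment> \<open>This is 4(2k+1) at k = \<open>Suc j\<close>.\<close>
  have "(8 * of_nat j + 12 :: rat) = of_nat (8 * j + 12)" by simp
  then have "(8 * of_nat j + 12 :: rat) \<noteq> 0" by (metis add_is_0 of_nat_eq_0_iff zero_neq_numeral)
  then show ?thesis
    using prefactor_T_Suc_odd[of 1 0 "Suc j" j] unfolding prefactor_T_1
    by (simp del: fact_Suc add: numeral_2_eq_2[symmetric] algebra_simps)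
qed

text \<open>The argument stays arbitrary in the induction because the shift calls for the value at k
  + 1. Using \<open>has_value\<close> also carries along that \<open>P n\<close> has no pole
  there.\<close>

lemma has_value_P:
  "n \<ge> 1 \<Longrightarrow> has_value (P n) (of_nat (Suc j)) (prefactor n (Suc j) * of_nat (T n (Suc j)))"
proof (induction n arbitrary: j rule: nat_induct_at_least)
  case base
  then show ?case unfolding prefactor_T_1 P_1 by (rule has_value_1)
next
  case (Suc n)
  define k where "k = Suc j"
  have here: "has_value (P n) (of_nat k) (prefactor n k * of_nat (T n k))"
    unfolding k_def by (rule Suc.IH)
  have "(of_nat k + 1 :: rat) = of_nat (Suc k)" by simp
  then have "has_value (P n) (of_nat k + 1) (prefactor n (Suc k) * of_nat (T n (Suc k)))"
    using Suc.IH[of k] by metis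
  then have shift: "has_value (rf_shift (P n)) (of_nat k) (prefactor n (Suc k) * of_nat (T n (Suc k)))"
    by (rule has_value_rf_shift)
  \<comment> \<open>n = 1 stands apart because \<open>P 2\<close> is set by definition, not by the
    recurrence.\<close>
  consider "n = 1" | m where "n \<ge> 2" "n = 2 * m + 1" | m where "n \<ge> 2" "n = 2 * Suc m"
    by (metis Suc.hyps Suc_1 Suc_eq_plus1 Suc_leI evenE le_neq_implies_less mult_0_right not0_implies_Suc
        not_one_le_zero oddE)
  then show ?case
  proof cases
    case 1
    then show ?thesis using prefactor_T_2[of j] P_2 has_value_1
      by (simp add: numeral_2_eq_2[symmetric] del: P.simps)
  next
    case (2 m)
    have P: "P (Suc n) = (2 * (X + of_nat n) * P n + (2 * X + of_nat n) * rf_shift (P n)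
         + (4 * X + of_nat n) * ell (2 * m + 1)) / (4 * (2 * X + of_nat n))"
      using 2 by simp
    have "4 * (2 * of_nat k + of_nat n) = (of_nat (4 * (2 * k + n)) :: rat)" by simp
    then have nz: "4 * (2 * of_nat k + of_nat n) \<noteq> (0 :: rat)"
      by (metis 2(1) add_is_0 mult_is_0 not_numeral_le_zero of_nat_eq_0_iff zero_neq_numeral)
    show ?thesis
      unfolding k_def[symmetric] P prefactor_T_Suc_odd[OF 2(2) k_def]
      by (intro has_value_intros has_value_ell here shift nz)
  next
    case (3 m)
    have P: "P (Suc n) = (4 * (X + of_nat n) * P n + 2 * (2 * X + of_nat n + 1) * rf_shift (P n)
         + (4 * X + of_nat n) * ell (2 * m + 1)) / 4"
      using 3 by simp
    show ?thesis
      unfolding k_def[symmetric] P prefactor_T_Suc_even[OF 3(2) k_def]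
      by (intro has_value_intros has_value_ell here shift) simp
  qed
qed

section \<open>Double factorial and binomial forms of the prefactor\<close>

text \<open>The even factors 2, 4, ..., 2m of (2m+1)! multiply to 2^m m!.\<close>

lemma double_fact_odd: "of_nat (double_fact (2 * m + 1)) * (2 ^ m * fact m) = (fact (2 * m + 1) :: rat)"
proof (induction m)
  case 0
  have "{i. i = Suc 0 \<and> odd i} = {1}" by auto
  then show ?case by (simp add: double_fact_def)
next
  case (Suc m)
  have "{j \<in> {1..2 * Suc m + 1}. even j \<longleftrightarrow> even (2 * Suc m + 1)}
      = insert (2 * m + 3) {j \<in> {1..2 * m + 1}. even j \<longleftrightarrow> even (2 * m + 1)}"
    by (auto simp: le_Suc_eq)
  then have "double_fact (2 * Suc m + 1) = (2 * m + 3) * double_fact (2 * m + 1)"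
    by (simp add: double_fact_def)
  moreover have "fact (2 * Suc m + 1) = (of_nat (2 * m + 3) * of_nat (2 * m + 2) * fact (2 * m + 1) :: rat)"
    by (simp add: algebra_simps)
  ultimately show ?case unfolding Suc.IH[symmetric] by (simp add: algebra_simps)
qed

lemma prefactor_double_fact:
  assumes "k \<ge> 1"
  shows "prefactor n k = 2 powi (- int (n div 2 + k - 1))
          * (fact (n + k - 1) / of_nat (double_fact (2 * (n div 2) + 2 * k - 1)))"
proof -
  define m where "m = n div 2 + k - 1"
  \<comment> \<open>This puts the denominator in the form (2m+1)!, whose factor m! cancels the first
    factorial of the prefactor.\<close>
  have m: "2 * (n div 2) + 2 * k - 1 = 2 * m + 1" using assms by (simp add: m_def)
  have "of_nat (double_fact (2 * m + 1)) \<noteq> (0::rat)"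
    using double_fact_odd[of m] by (metis fact_nonzero mult_zero_left)
  then show ?thesis
    unfolding prefactor_def m m_def[symmetric] double_fact_odd[symmetric]
    by (simp add: power_int_minus divide_simps)
qed

text \<open>In factorials, (k-1)! cancels between the two binomials, and the last factor cancels the
  remaining factorial in the denominator of the upper one.\<close>

lemma prefactor_odd:
  assumes "k \<ge> 1" "odd n"
  shows "prefactor n k = of_nat (((n - 1) div 2 + k - 1) choose (k - 1))
    / of_nat ((n + 2 * k - 2) choose (k - 1)) * fact ((n - 1) div 2)"
proof -
  obtain j m where k: "k = Suc j" and n: "n = 2 * m + 1"
    using assms by (metis Suc_le_D One_nat_def oddE)
  have "of_nat ((2 * m + 1 + 2 * j) choose j)
      = (fact (2 * m + 1 + 2 * j) / (fact j * fact (2 * m + 1 + j)) :: rat)"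
    by (subst binomial_fact) (simp_all add: algebra_simps del: fact_Suc)
  moreover have "of_nat ((m + j) choose j) = (fact (m + j) / (fact j * fact m) :: rat)"
    by (subst binomial_fact) simp_all
  ultimately show ?thesis by (simp add: prefactor_def k n del: fact_Suc)
qed

text \<open>The same cancellation with k! in place of (k-1)!; positivity of \<open>n\<close> makes
  \<open>n div 2 - 1\<close> a genuine predecessor.\<close>

lemma prefactor_even:
  assumes "k \<ge> 1" "even n" "n \<ge> 1"
  shows "prefactor n k = of_nat ((n div 2 + k - 1) choose k)
    / of_nat ((n + 2 * k - 1) choose k) * fact (n div 2 - 1)"
proof -
  obtain m where n: "n = 2 * Suc m"
    using assms by (metis evenE mult_is_0 not_one_le_zero not0_implies_Suc)
  have "of_nat ((2 * m + 1 + 2 * k) choose k)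
      = (fact (2 * m + 1 + 2 * k) / (fact k * fact (2 * m + 1 + k)) :: rat)"
    by (subst binomial_fact) (simp_all add: algebra_simps del: fact_Suc)
  moreover have "of_nat ((m + k) choose k) = (fact (m + k) / (fact k * fact m) :: rat)"
    by (subst binomial_fact) simp_all
  ultimately show ?thesis by (simp add: prefactor_def n del: fact_Suc)
qed

theorem theorem1:
  fixes n k :: nat
  assumes "n \<ge> 1" and "k \<ge> 1"
  shows "rf_eval (P n) (of_nat k) =
      (if odd n then
         of_nat (((n - 1) div 2 + k - 1) choose (k - 1)) / of_nat ((n + 2 * k - 2) choose (k - 1))
           * fact ((n - 1) div 2) * of_nat (T n k)
       else
         of_nat ((n div 2 + k - 1) choose k) / of_nat ((n + 2 * k - 1) choose k)
           * fact (n div 2 - 1) * of_nat (T n k))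
    \<and> rf_eval (P n) (of_nat k) =
        2 powi (- int (n div 2 + k - 1))
          * (fact (n + k - 1) / of_nat (double_fact (2 * (n div 2) + 2 * k - 1)))
          * of_nat (T n k)"
proof -
  obtain j where "k = Suc j" using assms(2) by (cases k) auto
  then have "rf_eval (P n) (of_nat k) = prefactor n k * of_nat (T n k)"
    using has_value_P[OF assms(1)] by (blast intro: rf_eval_has_value)
  then show ?thesis
    using prefactor_double_fact[OF assms(2), of n] prefactor_odd[OF assms(2), of n]
      prefactor_even[OF assms(2) _ assms(1)] by metis
qed

end
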